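(* Let $m\ge1$ and let $\mathbf r(t)=\sum_{i=0}^{2m+1}\mathbf r_iN^3_{i,\rho}(t)$, $t\in[t_1,t_{m+1}]$, be a clamped cubic Pythagorean-Hodograph B-spline curve with the data $\mathbf z_k,d_k,\mathbf p_k,\sigma_k,\mathbf r_k$ described in the context, with $\mathbf z(t)\neq0$ on $[t_1,t_{m+1}]$. Put $d_0=d_{m+1}=0$ and $\tau=\{\langle0\rangle^6<\langle t_2\rangle^5<\dots<\langle t_m\rangle^5<\langle t_{m+1}\rangle^6\}$. Then for every $h\in\mathbb R$ the offset curve $\mathbf r_h=\mathbf r-\mathrm i h\,\mathbf r'/|\mathbf r'|$ satisfies $$\mathbf r_h(t)=\frac{\sum_{k=0}^{5m}\mathbf q_kN^5_{k,\tau}(t)}{\sum_{k=0}^{5m}\gamma_kN^5_{k,\tau}(t)},\quad t\in[t_1,t_{m+1}],$$ where $\gamma_{5k}=\sigma_{2k}$ for $0\le k\le m$ and, for $0\le k\le m-1$, $$\gamma_{5k+1}=\tfrac35\sigma_{2k}+\tfrac25\sigma_{2k+1},\quad \gamma_{5k+2}=\tfrac3{10}\sigma_{2k}+\tfrac35\sigma_{2k+1}+\tfrac1{10}\sigma_{2k+2},$$ $$\gamma_{5k+3}=\tfrac1{10}\sigma_{2k}+\tfrac35\sigma_{2k+1}+\tfrac3{10}\sigma_{2k+2},\quad \gamma_{5k+4}=\tfrac25\sigma_{2k+1}+\tfrac35\sigma_{2k+2};$$ and, writing $\mathbf c_k=\frac{d_{k+1}}{d_k+d_{k+1}}\mathbf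 r_{2k}+\frac{d_k}{d_k+d_{k+1}}\mathbf r_{2k+1}$ for $0\le k\le m$, $\mathbf q_{5k}=\mathbf c_k\sigma_{2k}-\mathrm i h\,\mathbf p_{2k}$ for $0\le k\le m$ and, for $0\le k\le m-1$, $$\mathbf q_{5k+1}=\tfrac35\mathbf r_{2k+1}\sigma_{2k}+\tfrac25\mathbf c_k\sigma_{2k+1}-\mathrm i h\big(\tfrac35\mathbf p_{2k}+\tfrac25\mathbf p_{2k+1}\big),$$ $$\mathbf q_{5k+2}=\tfrac3{10}\mathbf r_{2k+2}\sigma_{2k}+\tfrac35\mathbf r_{2k+1}\sigma_{2k+1}+\tfrac1{10}\mathbf c_k\sigma_{2k+2}-\mathrm i h\big(\tfrac3{10}\mathbf p_{2k}+\tfrac35\mathbf p_{2k+1}+\tfrac1{10}\mathbf p_{2k+2}\big),$$ $$\mathbf q_{5k+3}=\tfrac1{10}\mathbf c_{k+1}\sigma_{2k}+\tfrac35\mathbf r_{2k+2}\sigma_{2k+1}+\tfrac3{10}\mathbf r_{2k+1}\sigma_{2k+2}-\mathrm i h\big(\tfrac1{10}\mathbf p_{2k}+\tfrac35\mathbf p_{2k+1}+\tfrac3{10}\mathbf p_{2k+2}\big),$$ $$\mathbf q_{5k+4}=\tfrac25\mathbf c_{k+1}\sigma_{2k+1}+\tfrac35\mathbf r_{2k+2}\sigma_{2k+2}-\mathrm i h\big(\tfrac25\mathbf p_{2k+1}+\tfrac35\mathbf p_{2k+2}\big).$$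
   Context: Normalized B-splines: for a nondecreasing knot sequence $\mu=\{t_i\}$, $N^0_{i,\mu}(t)=1$ if $t\in[t_i,t_{i+1})$ and $0$ otherwise, and $N^n_{i,\mu}(t)=\frac{t-t_i}{t_{i+n}-t_i}N^{n-1}_{i,\mu}(t)+\frac{t_{i+n+1}-t}{t_{i+n+1}-t_{i+1}}N^{n-1}_{i+1,\mu}(t)$ with $0/0=0$; indexing starts at $0$. $\langle t\rangle^k$ denotes the knot $t$ repeated $k$ times. At the right end of the domain, values are left limits. Points of $\mathbb R^2$ are identified with complex numbers. Data: $0=t_1<t_2<\dots<t_{m+1}$, $d_k=t_{k+1}-t_k$ ($1\le k\le m$), $\mathbf z_0,\dots,\mathbf z_m\in\mathbb C$, $\mu=\{\langle0\rangle^2<t_2<\dots<t_m<\langle t_{m+1}\rangle^2\}$, $\mathbf z(t)=\sum_{i=0}^m\mathbf z_iN^1_{i,\mu}(t)$, $\rho=\{\langle0\rangle^4<\langle t_2\rangle^2<\dots<\langle t_m\rangle^2<\langle t_{m+1}\rangle^4\}$. $\mathbf p_{2k}=\mathbf z_k^2$, $\sigma_{2k}=\mathbf z_k\bar{\mathbf z}_k$ ($0\le k\le m$); $\mathbf p_{2k+1}=\mathbf z_k\mathbf z_{k+1}$, $\sigma_{2k+1}=\frac12(\mathbf z_k\bar{\mathbf z}_{k+1}+\mathbf z_{k+1}\bar{\mathbf z}_k)$ ($0\le k\le m-1$). $\mathbf r_0$ is arbitrary, $\mathbf r_1=\mathbf r_0+\frac{d_1}3\mathbf z_0^2$, $\mathbf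 r_{2i+2}=\mathbf r_{2i+1}+\frac{d_{i+1}}3\mathbf z_i\mathbf z_{i+1}$ ($0\le i\le m-1$), $\mathbf r_{2i+3}=\mathbf r_{2i+2}+\frac{d_{i+1}+d_{i+2}}3\mathbf z_{i+1}^2$ ($0\le i\le m-2$), $\mathbf r_{2m+1}=\mathbf r_{2m}+\frac{d_m}3\mathbf z_m^2$; one has $\mathbf r'=\mathbf z^2$. *)

theory Defs
  imports "HOL-Analysis.Analysis"
begin

text \<open>Knot sequences are lists, indexed from 0.  If one of the denominators in the recursion
  vanishes, then the basis function multiplied by that quotient vanishes identically, so the
  library convention \<open>x / 0 = 0\<close> realises the usual convention \<open>0 / 0 = 0\<close>.\<close>

primrec cox_de_boor :: "real list \<Rightarrow> nat \<Rightarrow> nat \<Rightarrow> real \<Rightarrow> real" where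
  "cox_de_boor U 0 i s = (if s \<in> {U ! i ..< U ! (i + 1)} then 1 else 0)"
| "cox_de_boor U (Suc n) i s =
     (s - U ! i) / (U ! (i + Suc n) - U ! i) * cox_de_boor U n i s
   + (U ! (i + Suc n + 1) - s) / (U ! (i + Suc n + 1) - U ! (i + 1)) * cox_de_boor U n (i + 1) s"

text \<open>The half-open spans make every basis function vanish at the last knot; there the value is
  taken to be the left limit instead.\<close>

definition bspline_basis :: "real list \<Rightarrow> nat \<Rightarrow> nat \<Rightarrow> real \<Rightarrow> real" where
  "bspline_basis U n i s =
     (if s = last U then Lim (at_left s) (cox_de_boor U n i) else cox_de_boor U n i s)"

definition bspline :: "real list \<Rightarrow> nat \<Rightarrow> nat \<Rightarrow> (nat \<Rightarrow> complex) \<Rightarrow> real \<Rightarrow> complex" where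
  "bspline U n N a s = (\<Sum>i=0..N. a i * of_real (bspline_basis U n i s))"

definition clamped_knots :: "(nat \<Rightarrow> real) \<Rightarrow> nat \<Rightarrow> nat \<Rightarrow> nat \<Rightarrow> real list" where
  "clamped_knots t m a b =
     replicate a (t 1) @ concat (map (\<lambda>k. replicate b (t k)) [2..<m+1]) @ replicate a (t (m + 1))"

text \<open>The derivative is taken within the parameter domain, hence is one-sided at its end points.\<close>

definition offset_curve :: "real set \<Rightarrow> (real \<Rightarrow> complex) \<Rightarrow> real \<Rightarrow> real \<Rightarrow> complex" where
  "offset_curve I f h s =
     f s - \<i> * of_real h * vector_derivative f (at s within I)
             / of_real (norm (vector_derivative f (at s within I)))"

end

(* On a nonempty knot span every B-spline is a polynomial, and all knots that influence it there
   have full multiplicity for the degree 1 and degree 5 splines, so that these are Bezier curves.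
   For the cubic r with double knots, knot insertion gives the Bezier points
   c_k, r_(2k+1), r_(2k+2), c_(k+1).  The recursion for r then says r' = z^2, hence |r'| = z * cnj z,
   and the offset is (r * (z * cnj z) - i h z^2) / (z * cnj z).  The coefficients gamma and q come
   from writing denominator and numerator in the Bernstein basis of degree 5. *)

theory Submission
  imports Defs
begin

section \<open>B-splines as polynomials on a single knot span\<close>

text \<open>The Cox-de Boor recursion started as if the parameter were in the span \<open>j\<close>: a polynomial in the
  parameter that extends the restriction of the basis function to that span.\<close>

primrec span_basis :: "real list \<Rightarrow> nat \<Rightarrow> nat \<Rightarrow> nat \<Rightarrow> real \<Rightarrow> real" where
  "span_basis U j 0 i s = (if i = j then 1 else 0)"
| "span_basis U j (Suc n) i s =
     (s - U ! i) / (U ! (i + Suc n) - U ! i) * span_basis U j n i s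
   + (U ! (i + Suc n + 1) - s) / (U ! (i + Suc n + 1) - U ! (i + 1)) * span_basis U j n (i + 1) s"

text \<open>Only the start of the recursion depends on the span. Since \<open>U\<close> is sorted,
  its half-open spans are disjoint, so at degree 0 just the index \<open>j\<close> survives; the
  recursive steps are the same on both sides.\<close>

lemma cox_de_boor_eq_span_basis:
  assumes "sorted U" "j + 1 < length U" "s \<in> {U ! j..<U ! (j + 1)}" "i + n + 1 < length U"
  shows "cox_de_boor U n i s = span_basis U j n i s"
  using assms(4)
proof (induction n arbitrary: i)
  case 0
  have "i = j" if "U ! i \<le> s" "s < U ! (i + 1)"
  proof (rule ccontr)
    assume "i \<noteq> j"
    then consider "i + 1 \<le> j" | "j + 1 \<le> i" by linarith
    then show False
    proof cases
      case 1
      then have "U ! (i + 1) \<le> U ! j"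
        using assms by (intro sorted_nth_mono) auto
      then show False using that assms(3) by auto
    next
      case 2
      then have "U ! (j + 1) \<le> U ! i"
        using assms 0 by (intro sorted_nth_mono) auto
      then show False using that assms(3) by auto
    qed
  qed
  then have "s \<in> {U ! i..<U ! (i + 1)} \<longleftrightarrow> i = j" using assms(3) by (meson atLeastLessThan_iff)
  then show ?case by simp
next
  case (Suc n)
  then show ?case by simp
qed

lemma continuous_span_basis: "isCont (span_basis U j n i) s"
proof (induction n arbitrary: i)
  case 0
  have "span_basis U j 0 i = (\<lambda>s. if i = j then 1 else 0)" by auto
  then show ?case by simp
next
  case (Suc n)
  have "span_basis U j (Suc n) i = (\<lambda>s.
     (s - U ! i) / (U ! (i + Suc n) - U ! i) * span_basis U j n i s
   + (U ! (i + Suc n + 1) - s) / (U ! (i + Suc n + 1) - U ! (i + 1)) * span_basis U j n (i + 1) s)"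
    by auto
  then show ?case
    \<comment> \<open>The denominators are constant in the parameter, so each division is a
      multiplication by a constant, also where a denominator vanishes.\<close>
    using Suc by (auto simp: divide_inverse intro!: continuous_intros)
qed

lemma span_basis_eq_0: "i + n < j \<or> j < i \<Longrightarrow> span_basis U j n i s = 0"
  by (induction n arbitrary: i) auto

text \<open>At the last knot the left limit is taken through the nonempty span \<open>j\<close>,
  where the basis function is a polynomial; by continuity the limit is the value of that
  polynomial.\<close>

lemma bspline_basis_eq_span_basis:
  assumes U: "sorted U" "j + 1 < length U" "U ! j < U ! (j + 1)" "i + n + 1 < length U"
    and s: "s \<in> {U ! j..<U ! (j + 1)} \<or> s = U ! (j + 1) \<and> U ! (j + 1) = last U"
  shows "bspline_basis U n i s = span_basis U j n i s"
proof (cases "s = last U")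
  case False
  then show ?thesis
    using s cox_de_boor_eq_span_basis[OF U(1,2) _ U(4)] by (auto simp: bspline_basis_def)
next
  case True
  \<comment> \<open>A point of the half-open span would lie strictly below \<open>last U\<close>, so
    \<open>s\<close> must be the right end of span \<open>j\<close>.\<close>
  have "U ! (j + 1) \<le> U ! (length U - 1)"
    using U by (intro sorted_nth_mono) auto
  moreover have "last U = U ! (length U - 1)"
    using U by (intro last_conv_nth) auto
  ultimately have s': "s = U ! (j + 1)" using True s by (metis atLeastLessThan_iff not_le)
  have "(span_basis U j n i \<longlongrightarrow> span_basis U j n i s) (at_left s)"
    using continuous_span_basis[of s U j n i] by (simp add: isCont_def filterlim_at_split)
  moreover have "eventually (\<lambda>x. span_basis U j n i x = cox_de_boor U n i x) (at_left s)"
    using eventually_at_left_real[OF U(3)] unfolding s'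
    by eventually_elim (use cox_de_boor_eq_span_basis[OF U(1,2) _ U(4)] in auto)
  ultimately have "(cox_de_boor U n i \<longlongrightarrow> span_basis U j n i s) (at_left s)"
    by (simp add: tendsto_cong)
  then show ?thesis
    using True by (simp add: bspline_basis_def tendsto_Lim)
qed

text \<open>Local support: on span \<open>i + n\<close> only the basis functions \<open>i\<close> to
  \<open>i + n\<close> can be nonzero, and \<open>i + n \<le> N\<close> puts all of them into the
  sum.\<close>

lemma bspline_on_span:
  assumes U: "sorted U" "i + n + 1 < length U" "U ! (i + n) < U ! (i + n + 1)"
    and N: "i + n \<le> N" "N + n + 1 < length U"
    and s: "s \<in> {U ! (i + n)..<U ! (i + n + 1)} \<or> s = U ! (i + n + 1) \<and> U ! (i + n + 1) = last U"
  shows "bspline U n N a s = (\<Sum>l\<le>n. a (i + l) * of_real (span_basis U (i + n) n (i + l) s))"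
proof -
  have "bspline U n N a s = (\<Sum>l=0..N. a l * of_real (span_basis U (i + n) n l s))"
    unfolding bspline_def
    by (intro sum.cong refl) (use bspline_basis_eq_span_basis[OF U _ s] N in auto)
  also have "\<dots> = (\<Sum>l=i..i+n. a l * of_real (span_basis U (i + n) n l s))"
    by (intro sum.mono_neutral_right) (use N in \<open>auto simp: span_basis_eq_0\<close>)
  also have "\<dots> = (\<Sum>l\<le>n. a (i + l) * of_real (span_basis U (i + n) n (i + l) s))"
    using sum.shift_bounds_cl_nat_ivl[of "\<lambda>l. a l * of_real (span_basis U (i + n) n l s)" 0 i n]
    by (simp add: atMost_atLeast0 add.commute)
  finally show ?thesis .
qed

text \<open>With \<open>n\<close> coincident knots on either side of the span, the two quotients of
  the recursion become \<open>u\<close> and \<open>1 - u\<close> for the local parameter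
  \<open>u\<close>, which gives the recursion of the Bernstein polynomials.\<close>

lemma span_basis_eq_Bernstein:
  assumes "\<forall>l\<in>{1..n}. U ! (i + l) = a \<and> U ! (i + n + l) = b" "a < b" "l \<le> n"
  shows "span_basis U (i + n) n (i + l) s = Bernstein n l ((s - a) / (b - a))"
  using assms(1,3)
proof (induction n arbitrary: i l)
  case 0
  then show ?case by (simp add: Bernstein_def)
next
  case (Suc n)
  define u where "u = (s - a) / (b - a)"
  have v: "1 - u = (b - s) / (b - a)"
    using assms(2) by (simp add: u_def field_simps)
  \<comment> \<open>Lowering the degree drops the outermost knot on each side. The first index moves
    to \<open>Suc i\<close> while the span stays the same.\<close>
  have IH: "span_basis U (i + Suc n) n (i + Suc l') s = Bernstein n l' u" if "l' \<le> n" for l'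
  proof -
    have "\<forall>l\<in>{1..n}. U ! (Suc i + l) = a \<and> U ! (Suc i + n + l) = b"
    proof
      fix l assume "l \<in> {1..n}"
      then show "U ! (Suc i + l) = a \<and> U ! (Suc i + n + l) = b"
        using Suc.prems(1)[rule_format, of "Suc l"] Suc.prems(1)[rule_format, of l] by simp
    qed
    from Suc.IH[OF this that] show ?thesis by (simp add: u_def)
  qed
  have 1: "(s - U ! (i + l)) / (U ! (i + l + Suc n) - U ! (i + l)) * span_basis U (i + Suc n) n (i + l) s
       = (case l of 0 \<Rightarrow> 0 | Suc l' \<Rightarrow> u * Bernstein n l' u)"
  proof (cases l)
    case 0
    then show ?thesis by (simp add: span_basis_eq_0)
  next
    case (Suc l')
    then show ?thesis
      using IH[of l'] Suc.prems(1)[rule_format, of l] Suc.prems(2)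
      by (simp add: u_def add_ac)
  qed
  have 2: "(U ! (i + l + Suc n + 1) - s) / (U ! (i + l + Suc n + 1) - U ! (i + l + 1))
         * span_basis U (i + Suc n) n (i + l + 1) s
       = (if l \<le> n then (1 - u) * Bernstein n l u else 0)"
  proof (cases "l \<le> n")
    case True
    then show ?thesis
      using IH[of l] Suc.prems(1)[rule_format, of "Suc l"] by (simp add: v add_ac)
  next
    case False
    then show ?thesis using Suc.prems(2) by (simp add: span_basis_eq_0)
  qed
  have "span_basis U (i + Suc n) (Suc n) (i + l) s
      = (case l of 0 \<Rightarrow> 0 | Suc l' \<Rightarrow> u * Bernstein n l' u)
      + (if l \<le> n then (1 - u) * Bernstein n l u else 0)"
    unfolding span_basis.simps 1 2 ..
  also have "\<dots> = Bernstein (Suc n) l u"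
  proof (cases l)
    case 0
    then show ?thesis by (simp add: Bernstein_def)
  next
    case (Suc l')
    show ?thesis
    proof (cases "l \<le> n")
      case True
      then have "n - l' = Suc (n - l)" using Suc by simp
      then show ?thesis using Suc True by (simp add: Bernstein_def algebra_simps)
    next
      case False
      then have "l' = n" using Suc Suc.prems(2) by simp
      then show ?thesis using Suc by (simp add: Bernstein_def)
    qed
  qed
  finally show ?case by (simp add: u_def)
qed

section \<open>Positions and order of the clamped knots\<close>

lemma length_concat_replicate:
  "length (concat (map (\<lambda>k. replicate b (f k)) xs)) = length xs * b"
  by (induction xs) auto

lemma nth_concat_replicate:
  "i < length xs * b \<Longrightarrow> concat (map (\<lambda>k. replicate b (f k)) xs) ! i = f (xs ! (i div b))"
proof (induction xs arbitrary: i)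
  case (Cons x xs)
  show ?case
  proof (cases "i < b")
    case False
    then have "i div b = Suc ((i - b) div b)"
      using Cons.prems by (intro le_div_geq) (auto intro!: Nat.gr0I)
    then show ?thesis using Cons False by (simp add: nth_append)
  qed (use Cons in \<open>simp add: nth_append\<close>)
qed simp

lemma length_clamped_knots: "length (clamped_knots t m a b) = 2 * a + (m - 1) * b"
  by (simp add: clamped_knots_def length_concat_replicate del: upt_Suc)

lemma nth_clamped_knots:
  assumes "i < length (clamped_knots t m a b)"
  shows "clamped_knots t m a b ! i =
    t (if i < a then 1 else if i < a + (m - 1) * b then 2 + (i - a) div b else m + 1)"
proof -
  define xs where "xs = [2..<m + 1]"
  have len: "length xs = m - 1" by (simp add: xs_def del: upt_Suc)
  have "xs ! ((i - a) div b) = 2 + (i - a) div b" if "\<not> i < a" "i < a + (m - 1) * b"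
  proof -
    have "(i - a) div b < m - 1"
      using that by (intro less_mult_imp_div_less) auto
    then show ?thesis by (simp add: xs_def del: upt_Suc)
  qed
  then show ?thesis
    using assms unfolding length_clamped_knots clamped_knots_def xs_def[symmetric]
    by (auto simp: nth_append length_concat_replicate nth_concat_replicate len)
qed

text \<open>Dropping the \<open>a - b\<close> surplus copies at the front leaves blocks of length
  \<open>b\<close>. The last \<open>b\<close> copies of the first knot form block 0 and the first
  \<open>b\<close> copies of the last knot form block \<open>m\<close>, so end knots and interior
  knots share one formula.\<close>

lemma nth_clamped_knots_interior:
  assumes "1 \<le> m" "b \<le> a" "k \<le> m" "l < b"
  shows "clamped_knots t m a b ! (a - b + k * b + l) = t (k + 1)"
proof -
  have kb: "k * b \<le> m * b" using assms by simp
  have mb: "m * b = (m - 1) * b + b" using assms(1) by (cases m) auto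
  have len: "a - b + k * b + l < length (clamped_knots t m a b)"
    unfolding length_clamped_knots using kb mb assms by linarith
  consider "k = 0" | k' where "k = Suc k'" "k < m" | "k = m" "k \<noteq> 0"
    using assms(3) by (cases k) (auto simp: le_less)
  then show ?thesis
  proof cases
    case 1
    then have "a - b + k * b + l < a" using assms by simp
    then show ?thesis using nth_clamped_knots[OF len] 1 by simp
  next
    case 2
    have "Suc k' * b \<le> (m - 1) * b" using 2 by (intro mult_le_mono1) auto
    moreover have "a - b + k * b + l = a + (k' * b + l)" using 2 assms by simp
    moreover have "(k' * b + l) div b = k'" using assms(4) by simp
    ultimately show ?thesis using nth_clamped_knots[OF len] assms 2 by simp
  next
    case 3
    have "a - b + k * b + l = a + (m - 1) * b + l" using 3 mb assms by simp
    then show ?thesis using nth_clamped_knots[OF len] 3 by simp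
  qed
qed

lemma last_clamped_knots: "0 < a \<Longrightarrow> last (clamped_knots t m a b) = t (m + 1)"
  by (simp add: clamped_knots_def)

lemma sorted_clamped_knots:
  assumes "1 \<le> m" and t: "\<And>i j. 1 \<le> i \<Longrightarrow> i \<le> j \<Longrightarrow> j \<le> m + 1 \<Longrightarrow> t i \<le> t j"
  shows "sorted (clamped_knots t m a b)"
proof -
  define g where
    "g i = (if i < a then 1 else if i < a + (m - 1) * b then 2 + (i - a) div b else m + 1)" for i
  have "(i - a) div b < m - 1" if "\<not> i < a" "i < a + (m - 1) * b" for i
    using that by (intro less_mult_imp_div_less) auto
  then have le: "2 + (i - a) div b \<le> m + 1" if "\<not> i < a" "i < a + (m - 1) * b" for i
    using that by fastforce
  have "t (g i) \<le> t (g j)" if "i \<le> j" for i j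
    using that assms(1) le[of j] le[of i]
    by (intro t) (auto simp: g_def intro: div_le_mono)
  then show ?thesis
    by (auto simp: sorted_iff_nth_mono nth_clamped_knots g_def[symmetric])
qed

section \<open>Splines with interior knots of full multiplicity\<close>

text \<open>Every span has \<open>n\<close> equal knots on each side, so its piece is a Bezier
  curve, and neighbouring pieces share one control point. It serves for \<open>n = 1\<close> (the
  curve z) and \<open>n = 5\<close> (numerator and denominator).\<close>

lemma bspline_clamped_Bernstein:
  assumes "1 \<le> m" and t: "\<And>i j. 1 \<le> i \<Longrightarrow> i < j \<Longrightarrow> j \<le> m + 1 \<Longrightarrow> t i < t j"
    and "0 < n" "k < m"
    and s: "s \<in> {t (k + 1)..<t (k + 2)} \<or> s = t (k + 2) \<and> k + 1 = m"
  shows "bspline (clamped_knots t m (n + 1) n) n (m * n) a s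
    = (\<Sum>l\<le>n. a (k * n + l) * of_real (Bernstein n l ((s - t (k + 1)) / (t (k + 2) - t (k + 1)))))"
proof -
  let ?U = "clamped_knots t m (n + 1) n"
  \<comment> \<open>Here \<open>a - b = 1\<close>, which accounts for \<open>l\<close> starting at
    1.\<close>
  have nth: "?U ! (k' * n + l) = t (k' + 1)" if "l \<in> {1..n}" "k' \<le> m" for k' l
    using nth_clamped_knots_interior[of m n "n + 1" k' "l - 1" t] that assms(1) by auto
  have knots: "\<forall>l\<in>{1..n}. ?U ! (k * n + l) = t (k + 1) \<and> ?U ! (k * n + n + l) = t (k + 2)"
    using nth[of _ k] nth[of _ "k + 1"] \<open>k < m\<close> by (simp add: algebra_simps)
  then have ends: "?U ! (k * n + n) = t (k + 1)" "?U ! (k * n + n + 1) = t (k + 2)"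
    using bspec[OF knots, of n] bspec[OF knots, of 1] \<open>0 < n\<close> by auto
  have kn: "k * n + n \<le> m * n"
    using mult_le_mono1[of "k + 1" m n] \<open>k < m\<close> by simp
  have len: "length ?U = m * n + n + 2"
    using \<open>1 \<le> m\<close> by (cases m) (auto simp: length_clamped_knots)
  have "t i \<le> t j" if "1 \<le> i" "i \<le> j" "j \<le> m + 1" for i j
    using t[of i j] that by (cases "i = j") auto
  then have "sorted ?U" using \<open>1 \<le> m\<close> by (intro sorted_clamped_knots) auto
  then have "bspline ?U n (m * n) a s
    = (\<Sum>l\<le>n. a (k * n + l) * of_real (span_basis ?U (k * n + n) n (k * n + l) s))"
    using s t[of "k + 1" "k + 2"] \<open>k < m\<close> kn
    by (intro bspline_on_span) (auto simp: ends[simplified] len[simplified] last_clamped_knots)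
  also have "\<dots> = (\<Sum>l\<le>n. a (k * n + l) * of_real (Bernstein n l ((s - t (k + 1)) / (t (k + 2) - t (k + 1)))))"
    using knots t[of "k + 1" "k + 2"] \<open>k < m\<close>
    by (intro sum.cong refl) (simp add: span_basis_eq_Bernstein)
  finally show ?thesis .
qed

section \<open>Bezier points of the cubic spline with double knots\<close>

definition cubic_bezier :: "complex \<Rightarrow> complex \<Rightarrow> complex \<Rightarrow> complex \<Rightarrow> complex \<Rightarrow> complex" where
  "cubic_bezier b0 b1 b2 b3 w =
     (1 - w)^3 * b0 + 3 * w * (1 - w)^2 * b1 + 3 * w^2 * (1 - w) * b2 + w^3 * b3"

text \<open>The outer knots are parametrised by their distances \<open>A\<close> and \<open>C\<close> from the double knots, so that
  \<open>A = 0\<close> or \<open>C = 0\<close> covers the end spans.\<close>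

lemma cubic_span_double_knots:
  fixes r :: "nat \<Rightarrow> complex"
  assumes knots: "U ! (i + 1) = a - A" "U ! (i + 2) = a" "U ! (i + 3) = a"
      "U ! (i + 4) = b" "U ! (i + 5) = b" "U ! (i + 6) = b + C"
    and "0 \<le> A" "0 \<le> C" "0 < b - a"
  defines "B \<equiv> b - a"
  shows "(\<Sum>l\<le>3. r (i + l) * of_real (span_basis U (i + 3) 3 (i + l) s)) =
    cubic_bezier (of_real (B / (A + B)) * r i + of_real (A / (A + B)) * r (i + 1)) (r (i + 1)) (r (i + 2))
      (of_real (C / (B + C)) * r (i + 2) + of_real (B / (B + C)) * r (i + 3)) (of_real ((s - a) / B))"
proof -
  define u where "u = (s - a) / B"
  have B: "0 < B" using assms by simp
  have AB: "A + B \<noteq> 0" and BC: "B + C \<noteq> 0" using assms(7,8) B by auto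
  have s: "s = a + u * B" using B by (simp add: u_def)
  have b: "b = a + B" by (simp add: B_def)
  \<comment> \<open>Double knots are full multiplicity for degree 2, so the quadratic basis
    functions are Bernstein polynomials. The outer knots enter only in the last recursion step, to
    degree 3.\<close>
  have "\<forall>l\<in>{1..2}. U ! (i + 1 + l) = a \<and> U ! (i + 1 + 2 + l) = b"
  proof
    fix l :: nat assume "l \<in> {1..2}"
    then consider "l = 1" | "l = 2" by fastforce
    then show "U ! (i + 1 + l) = a \<and> U ! (i + 1 + 2 + l) = b"
      using knots by cases (simp_all add: numeral_eq_Suc)
  qed
  from span_basis_eq_Bernstein[OF this, of _ s]
  have quad: "span_basis U (i + 3) 2 (i + 1 + l) s = Bernstein 2 l u" if "l \<le> 2" for l
    using that assms(9) by (simp add: u_def B_def numeral_eq_Suc)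
  have Suc: "span_basis U (i + 3) 3 j s =
     (s - U ! j) / (U ! (j + 3) - U ! j) * span_basis U (i + 3) 2 j s
   + (U ! (j + 4) - s) / (U ! (j + 4) - U ! (j + 1)) * span_basis U (i + 3) 2 (j + 1) s" for j
    using span_basis.simps(2)[of U "i + 3" 2 j s] by (simp add: numeral_eq_Suc)
  have shift: "i + 1 + 0 = i + 1" "i + 1 + 1 = i + 2" "i + 1 + 2 = i + 3" "i + 1 + 3 = i + 4" "i + 1 + 4 = i + 5"
    "i + 2 + 1 = i + 3" "i + 2 + 3 = i + 5" "i + 2 + 4 = i + 6"
    "i + 3 + 1 = i + 4" "i + 3 + 3 = i + 6" by simp_all
  have quad': "span_basis U (i + 3) 2 i s = 0" "span_basis U (i + 3) 2 (i + 1) s = (1 - u)^2"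
    "span_basis U (i + 3) 2 (i + 2) s = 2 * u * (1 - u)" "span_basis U (i + 3) 2 (i + 3) s = u^2"
    "span_basis U (i + 3) 2 (i + 4) s = 0"
    using quad[of 0, unfolded shift] quad[of 1, unfolded shift] quad[of 2, unfolded shift]
    by (simp_all add: span_basis_eq_0 Bernstein_def)
  \<comment> \<open>All quotients of the last recursion step in terms of \<open>u\<close>;
    \<open>A / (A + B)\<close> and \<open>C / (B + C)\<close> are the knot insertion ratios.\<close>
  have ratios:
    "(s - (a - A)) / (b - (a - A)) = u + (1 - u) * (A / (A + B))"
    "(b - s) / (b - (a - A)) = (1 - u) * (B / (A + B))"
    "(b - s) / (b - a) = 1 - u" "(s - a) / (b - a) = u"
    "(b + C - s) / (b + C - a) = (1 - u) + u * (C / (B + C))"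
    "(s - a) / (b + C - a) = u * (B / (B + C))"
    unfolding s b using B AB BC by (simp_all add: field_simps)
  have 0: "span_basis U (i + 3) 3 i s = (1 - u)^3 * (B / (A + B))"
    unfolding Suc quad' knots ratios by (simp add: power3_eq_cube power2_eq_square)
  have 1: "span_basis U (i + 3) 3 (i + 1) s = (1 - u)^3 * (A / (A + B)) + 3 * u * (1 - u)^2"
    unfolding Suc shift quad' knots ratios by algebra
  have 2: "span_basis U (i + 3) 3 (i + 2) s = 3 * u^2 * (1 - u) + u^3 * (C / (B + C))"
    unfolding Suc shift quad' knots ratios by algebra
  have 3: "span_basis U (i + 3) 3 (i + 3) s = u^3 * (B / (B + C))"
    unfolding Suc shift quad' knots ratios by (simp add: power3_eq_cube power2_eq_square span_basis_eq_0)
  have sum: "(\<Sum>l\<le>3. f l) = f 0 + f 1 + f 2 + f 3" for f :: "nat \<Rightarrow> complex"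
    by (simp add: numeral_eq_Suc)
  show ?thesis
    unfolding cubic_bezier_def u_def[symmetric] sum add_0_right 0 1 2 3
    by (simp add: algebra_simps)
qed

text \<open>The neighbours of the two double knots lie at distances \<open>d k\<close> and
  \<open>d (k + 2)\<close>. At the ends of the domain, \<open>d 0 = 0\<close> and
  \<open>d (m + 1) = 0\<close> express that the fourfold end knot is its own neighbour.\<close>

lemma bspline_cubic_double_knots:
  fixes t d :: "nat \<Rightarrow> real" and c r :: "nat \<Rightarrow> complex"
  assumes "1 \<le> m" and t: "\<And>i j. 1 \<le> i \<Longrightarrow> i < j \<Longrightarrow> j \<le> m + 1 \<Longrightarrow> t i < t j"
    and d: "\<forall>k\<in>{1..m}. d k = t (k + 1) - t k" "d 0 = 0" "d (m + 1) = 0"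
    and c: "\<forall>k\<le>m. c k = of_real (d (k+1) / (d k + d (k+1))) * r (2*k)
                       + of_real (d k / (d k + d (k+1))) * r (2*k+1)"
    and "k < m" and s: "s \<in> {t (k + 1)..<t (k + 2)} \<or> s = t (k + 2) \<and> k + 1 = m"
  shows "bspline (clamped_knots t m 4 2) 3 (2*m+1) r s
    = cubic_bezier (c k) (r (2*k+1)) (r (2*k+2)) (c (k+1)) (of_real ((s - t (k+1)) / d (k+1)))"
proof -
  let ?U = "clamped_knots t m 4 2"
  have len: "length ?U = 2 * m + 6"
    using \<open>1 \<le> m\<close> by (cases m) (auto simp: length_clamped_knots)
  have nth: "?U ! (2 * k' + 2) = t (k' + 1)" "?U ! (2 * k' + 3) = t (k' + 1)" if "k' \<le> m" for k'
    using nth_clamped_knots_interior[of m 2 4 k' 0 t] nth_clamped_knots_interior[of m 2 4 k' 1 t]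
      that \<open>1 \<le> m\<close> by (simp_all add: numeral_eq_Suc mult.commute)
  have knots: "?U ! (2*k+1) = t (k+1) - d k" "?U ! (2*k+2) = t (k+1)" "?U ! (2*k+3) = t (k+1)"
      "?U ! (2*k+4) = t (k+2)" "?U ! (2*k+5) = t (k+2)" "?U ! (2*k+6) = t (k+2) + d (k+2)"
  proof -
    show "?U ! (2*k+1) = t (k+1) - d k"
    proof (cases k)
      case 0
      then show ?thesis using nth_clamped_knots[of 1 t m 4 2] len d by simp
    next
      case (Suc k')
      then show ?thesis using nth(2)[of k'] d(1) \<open>k < m\<close> by (simp add: numeral_eq_Suc)
    qed
    show "?U ! (2*k+6) = t (k+2) + d (k+2)"
    proof (cases "k + 1 = m")
      case True
      then have "?U ! (2*k+6) = t (m + 1)"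
        using nth_clamped_knots[of "2*k+6" t m 4 2] len by auto
      then show ?thesis using True d by auto
    next
      case False
      then show ?thesis using nth(1)[of "k + 2"] d(1) \<open>k < m\<close> by (simp add: numeral_eq_Suc)
    qed
  qed (use nth[of k] nth[of "k + 1"] \<open>k < m\<close> in \<open>simp_all add: numeral_eq_Suc\<close>)
  have shift: "2*k + 3 + 1 = 2*k + 4" by simp
  have "t i \<le> t j" if "1 \<le> i" "i \<le> j" "j \<le> m + 1" for i j
    using t[of i j] that by (cases "i = j") auto
  then have "sorted ?U" using \<open>1 \<le> m\<close> by (intro sorted_clamped_knots) auto
  then have "bspline ?U 3 (2*m+1) r s
    = (\<Sum>l\<le>3. r (2*k + l) * of_real (span_basis ?U (2*k + 3) 3 (2*k + l) s))"
    using s t[of "k + 1" "k + 2"] \<open>k < m\<close> bspline_on_span[of ?U "2*k" 3 "2*m+1" s r, unfolded shift knots]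
    by (auto simp: len last_clamped_knots)
  also have "\<dots> = cubic_bezier (c k) (r (2*k+1)) (r (2*k+2)) (c (k+1)) (of_real ((s - t (k+1)) / d (k+1)))"
  proof -
    have "0 \<le> d j" if "j \<le> m + 1" for j
    proof (cases "j \<in> {1..m}")
      case True
      then show ?thesis using d(1) t[of j "j + 1"] by auto
    next
      case False
      then have "j = 0 \<or> j = m + 1" using that by auto
      then show ?thesis using d by auto
    qed
    then have "0 \<le> d k" "0 \<le> d (k + 2)" using \<open>k < m\<close> by auto
    moreover have "d (k + 1) = t (k + 2) - t (k + 1)" using d(1) \<open>k < m\<close> by auto
    ultimately show ?thesis
      using cubic_span_double_knots[OF knots, of r s] c \<open>k < m\<close> t[of "k + 1" "k + 2"]
      by (simp add: numeral_eq_Suc)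
  qed
  finally show ?thesis .
qed

section \<open>Differentiating the piecewise cubic\<close>

text \<open>A limit within a union of two sets follows from the limits within each, so derivatives
  on adjacent intervals glue as soon as they have the same value.\<close>

lemma has_vector_derivative_piecewise:
  fixes f :: "real \<Rightarrow> 'a::real_normed_vector"
  assumes "0 < m" and a: "\<And>k. k < m \<Longrightarrow> a k \<le> a (Suc k)"
    and f: "\<And>k. k < m \<Longrightarrow> x \<in> {a k..a (Suc k)} \<Longrightarrow>
          (f has_vector_derivative D) (at x within {a k..a (Suc k)})"
  shows "(f has_vector_derivative D) (at x within {a 0..a m})"
proof -
  define P where "P S \<longleftrightarrow>
    ((\<lambda>y. (1 / norm (y - x)) *\<^sub>R (f y - (f x + (y - x) *\<^sub>R D))) \<longlongrightarrow> 0) (at x within S)" for S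
  have P: "(f has_vector_derivative D) (at x within S) \<longleftrightarrow> P S" for S
    by (simp add: has_vector_derivative_def has_derivative_within P_def bounded_linear_scaleR_left)
  have piece: "P {a k..a (Suc k)}" if "k < m" for k
  proof (cases "x \<in> {a k..a (Suc k)}")
    case True
    then show ?thesis using f[OF that] P by blast
  next
    case False
    \<comment> \<open>A point outside the closed interval is no limit point of it, so every limit
      there holds trivially.\<close>
    then have "at x within {a k..a (Suc k)} = bot"
      by (intro not_in_closure_trivial_limitI) simp
    then show ?thesis by (simp add: P_def)
  qed
  have "a 0 \<le> a n \<and> P {a 0..a n}" if "0 < n" "n \<le> m" for n
    using that
  proof (induction n rule: nat_induct_non_zero)
    case 1
    then show ?case using piece[of 0] a[of 0] by simp
  next
    case (Suc n)
    then have "{a 0..a (Suc n)} = {a 0..a n} \<union> {a n..a (Suc n)}" "a 0 \<le> a (Suc n)"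
      using a[of n] by auto
    then show ?case
      using Suc piece[of n] unfolding P_def by (auto intro: Lim_Un)
  qed
  then show ?thesis using assms(1) P by simp
qed

text \<open>The derivative of a cubic Bezier curve has the control points \<open>3 / e\<close> times
  the differences of the given ones. These are the squares and the product of \<open>z0\<close> and
  \<open>z1\<close>, the Bernstein coefficients of the square of the linear interpolant.\<close>

lemma cubic_bezier_has_vector_derivative:
  fixes e a :: real
  assumes "e \<noteq> 0"
    and "b1 = b0 + of_real (e / 3) * z0\<^sup>2" "b2 = b1 + of_real (e / 3) * z0 * z1"
      "b3 = b2 + of_real (e / 3) * z1\<^sup>2"
  shows "((\<lambda>x. cubic_bezier b0 b1 b2 b3 (of_real ((x - a) / e))) has_vector_derivative
      ((1 - of_real ((x - a) / e)) * z0 + of_real ((x - a) / e) * z1)\<^sup>2) (at x within S)"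
proof -
  define E where "E = complex_of_real e"
  have E: "E \<noteq> 0" using assms by (simp add: E_def)
  \<comment> \<open>The parameter is made complex so that the field derivative rules apply; the
    result is then restricted to the real line.\<close>
  define w where "w X = (X - of_real a) / E" for X
  have "((\<lambda>X. cubic_bezier b0 b1 b2 b3 (w X)) has_field_derivative
    ((1 - w (of_real x)) * z0 + w (of_real x) * z1)\<^sup>2) (at (of_real x))"
    unfolding cubic_bezier_def w_def assms(2-4) using E
    by (auto intro!: derivative_eq_intros simp: E_def[symmetric] power2_eq_square power3_eq_cube divide_simps; algebra)
  from has_vector_derivative_real_field[OF this, of S] show ?thesis
    by (simp add: w_def E_def)
qed

lemma exists_span:
  fixes t :: "nat \<Rightarrow> real"
  assumes "1 \<le> m" "s \<in> {t 1..t (m + 1)}"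
  obtains k where "k < m" "s \<in> {t (k + 1)..<t (k + 2)} \<or> s = t (k + 2) \<and> k + 1 = m"
proof -
  have "\<exists>k<m. s \<in> {t (k + 1)..<t (k + 2)} \<or> s = t (k + 2) \<and> k + 1 = m"
    using assms
  proof (induction m rule: nat_induct_at_least)
    case base
    then show ?case by (auto simp: numeral_eq_Suc)
  next
    case (Suc n)
    show ?case
    proof (cases "s < t (n + 1)")
      case True
      then show ?thesis using Suc by (fastforce simp: less_Suc_eq)
    next
      case False
      then show ?thesis using Suc.prems by (intro exI[of _ n]) auto
    qed
  qed
  then show ?thesis using that by blast
qed

section \<open>Degree 5 Bernstein form of denominator and numerator\<close>

text \<open>\<open>s0\<close>, \<open>s1\<close>, \<open>s2\<close> are the quadratic Bernstein
  coefficients of \<open>Z * Z'\<close>. Coefficient \<open>k\<close> of its product with a cubic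
  weights the pair \<open>j\<close>, \<open>k - j\<close> by
  \<open>(2 choose j) * (3 choose (k - j)) / (5 choose k)\<close>; for the denominator the cubic is
  the constant 1. \<open>Z'\<close> replaces the conjugate of \<open>Z\<close>, with which it agrees
  for real \<open>w\<close>, so that the identities are polynomial. \<open>H\<close> stands for
  \<open>\<i> * h\<close>.\<close>

lemma offset_weight_numerator_Bernstein:
  fixes w z0 z1 :: complex
  defines "Z \<equiv> (1 - w) * z0 + w * z1" and "Z' \<equiv> (1 - w) * cnj z0 + w * cnj z1"
    and "s0 \<equiv> z0 * cnj z0" and "s1 \<equiv> 1/2 * (z0 * cnj z1 + z1 * cnj z0)" and "s2 \<equiv> z1 * cnj z1"
    and "bern \<equiv> \<lambda>a0 a1 a2 a3 a4 a5. (1 - w)^5 * a0 + 5 * w * (1 - w)^4 * a1 + 10 * w^2 * (1 - w)^3 * a2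
          + 10 * w^3 * (1 - w)^2 * a3 + 5 * w^4 * (1 - w) * a4 + w^5 * a5"
  shows "bern s0 (3/5 * s0 + 2/5 * s1) (3/10 * s0 + 3/5 * s1 + 1/10 * s2)
      (1/10 * s0 + 3/5 * s1 + 3/10 * s2) (2/5 * s1 + 3/5 * s2) s2 = Z * Z'" (is ?weight)
    and "bern (b0 * s0 - H * z0\<^sup>2)
      (3/5 * b1 * s0 + 2/5 * b0 * s1 - H * (3/5 * z0\<^sup>2 + 2/5 * (z0 * z1)))
      (3/10 * b2 * s0 + 3/5 * b1 * s1 + 1/10 * b0 * s2
        - H * (3/10 * z0\<^sup>2 + 3/5 * (z0 * z1) + 1/10 * z1\<^sup>2))
      (1/10 * b3 * s0 + 3/5 * b2 * s1 + 3/10 * b1 * s2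
        - H * (1/10 * z0\<^sup>2 + 3/5 * (z0 * z1) + 3/10 * z1\<^sup>2))
      (2/5 * b3 * s1 + 3/5 * b2 * s2 - H * (2/5 * (z0 * z1) + 3/5 * z1\<^sup>2))
      (b3 * s2 - H * z1\<^sup>2)
    = cubic_bezier b0 b1 b2 b3 w * (Z * Z') - H * Z\<^sup>2" (is ?numerator)
proof -
  define v where "v = 1 - w"
  \<comment> \<open>Multiplying by this factor raises the degree from 2 to 5 and makes the identities homogeneous
    in \<open>v\<close> and \<open>w\<close>.\<close>
  have one: "(v + w)^3 = 1" by (simp add: v_def)
  have "bern s0 (3/5 * s0 + 2/5 * s1) (3/10 * s0 + 3/5 * s1 + 1/10 * s2)
      (1/10 * s0 + 3/5 * s1 + 3/10 * s2) (2/5 * s1 + 3/5 * s2) s2 = Z * Z' * (v + w)^3"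
    unfolding bern_def Z_def Z'_def s0_def s1_def s2_def v_def[symmetric]
    by (simp add: field_simps) algebra
  then show ?weight unfolding one by simp
  have "bern (b0 * s0 - H * z0\<^sup>2)
      (3/5 * b1 * s0 + 2/5 * b0 * s1 - H * (3/5 * z0\<^sup>2 + 2/5 * (z0 * z1)))
      (3/10 * b2 * s0 + 3/5 * b1 * s1 + 1/10 * b0 * s2
        - H * (3/10 * z0\<^sup>2 + 3/5 * (z0 * z1) + 1/10 * z1\<^sup>2))
      (1/10 * b3 * s0 + 3/5 * b2 * s1 + 3/10 * b1 * s2
        - H * (1/10 * z0\<^sup>2 + 3/5 * (z0 * z1) + 3/10 * z1\<^sup>2))
      (2/5 * b3 * s1 + 3/5 * b2 * s2 - H * (2/5 * (z0 * z1) + 3/5 * z1\<^sup>2))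
      (b3 * s2 - H * z1\<^sup>2)
    = cubic_bezier b0 b1 b2 b3 w * (Z * Z') - H * Z\<^sup>2 * (v + w)^3"
    unfolding bern_def Z_def Z'_def s0_def s1_def s2_def cubic_bezier_def v_def[symmetric]
    by (simp add: field_simps) algebra
  then show ?numerator unfolding one by simp
qed

theorem mainTheorem8:
  fixes m :: nat and t d :: "nat \<Rightarrow> real" and h :: real
    and z p \<sigma> r c \<gamma> q :: "nat \<Rightarrow> complex"
  assumes "m \<ge> 1"
    and "t 1 = 0"
    and "\<forall>k\<in>{1..m}. t k < t (k + 1)"
    and "\<forall>k\<in>{1..m}. d k = t (k + 1) - t k"
    and "d 0 = 0" and "d (m + 1) = 0"
    and "\<forall>k\<le>m. p (2*k) = (z k)\<^sup>2"
    and "\<forall>k\<le>m. \<sigma> (2*k) = z k * cnj (z k)"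
    and "\<forall>k<m. p (2*k+1) = z k * z (k+1)"
    and "\<forall>k<m. \<sigma> (2*k+1) = 1/2 * (z k * cnj (z (k+1)) + z (k+1) * cnj (z k))"
    and "r 1 = r 0 + of_real (d 1 / 3) * (z 0)\<^sup>2"
    and "\<forall>i<m. r (2*i+2) = r (2*i+1) + of_real (d (i+1) / 3) * z i * z (i+1)"
    and "\<forall>i. i + 2 \<le> m \<longrightarrow>
           r (2*i+3) = r (2*i+2) + of_real ((d (i+1) + d (i+2)) / 3) * (z (i+1))\<^sup>2"
    and "r (2*m+1) = r (2*m) + of_real (d m / 3) * (z m)\<^sup>2"
    and "\<forall>s\<in>{t 1..t (m+1)}. bspline (clamped_knots t m 2 1) 1 m z s \<noteq> 0"
    and "\<forall>k\<le>m. c k = of_real (d (k+1) / (d k + d (k+1))) * r (2*k)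
                       + of_real (d k / (d k + d (k+1))) * r (2*k+1)"
    and "\<forall>k\<le>m. \<gamma> (5*k) = \<sigma> (2*k)"
    and "\<forall>k<m. \<gamma> (5*k+1) = 3/5 * \<sigma> (2*k) + 2/5 * \<sigma> (2*k+1)"
    and "\<forall>k<m. \<gamma> (5*k+2) = 3/10 * \<sigma> (2*k) + 3/5 * \<sigma> (2*k+1) + 1/10 * \<sigma> (2*k+2)"
    and "\<forall>k<m. \<gamma> (5*k+3) = 1/10 * \<sigma> (2*k) + 3/5 * \<sigma> (2*k+1) + 3/10 * \<sigma> (2*k+2)"
    and "\<forall>k<m. \<gamma> (5*k+4) = 2/5 * \<sigma> (2*k+1) + 3/5 * \<sigma> (2*k+2)"
    and "\<forall>k\<le>m. q (5*k) = c k * \<sigma> (2*k) - \<i> * of_real h * p (2*k)"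
    and "\<forall>k<m. q (5*k+1) =
           3/5 * r (2*k+1) * \<sigma> (2*k) + 2/5 * c k * \<sigma> (2*k+1)
           - \<i> * of_real h * (3/5 * p (2*k) + 2/5 * p (2*k+1))"
    and "\<forall>k<m. q (5*k+2) =
           3/10 * r (2*k+2) * \<sigma> (2*k) + 3/5 * r (2*k+1) * \<sigma> (2*k+1) + 1/10 * c k * \<sigma> (2*k+2)
           - \<i> * of_real h * (3/10 * p (2*k) + 3/5 * p (2*k+1) + 1/10 * p (2*k+2))"
    and "\<forall>k<m. q (5*k+3) =
           1/10 * c (k+1) * \<sigma> (2*k) + 3/5 * r (2*k+2) * \<sigma> (2*k+1) + 3/10 * r (2*k+1) * \<sigma> (2*k+2)
           - \<i> * of_real h * (1/10 * p (2*k) + 3/5 * p (2*k+1) + 3/10 * p (2*k+2))"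
    and "\<forall>k<m. q (5*k+4) =
           2/5 * c (k+1) * \<sigma> (2*k+1) + 3/5 * r (2*k+2) * \<sigma> (2*k+2)
           - \<i> * of_real h * (2/5 * p (2*k+1) + 3/5 * p (2*k+2))"
  shows "\<forall>s\<in>{t 1..t (m+1)}.
           bspline (clamped_knots t m 6 5) 5 (5*m) \<gamma> s \<noteq> 0 \<and>
           offset_curve {t 1..t (m+1)} (bspline (clamped_knots t m 4 2) 3 (2*m+1) r) h s
             = bspline (clamped_knots t m 6 5) 5 (5*m) q s
               / bspline (clamped_knots t m 6 5) 5 (5*m) \<gamma> s"
proof
  note m = assms(1) and z_ne_0 = assms(15) and c = assms(16)
  have t: "t i < t j" if "1 \<le> i" "i < j" "j \<le> m + 1" for i j
    using that(2,1,3)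
  proof (induction rule: strict_inc_induct)
    case (base i)
    then show ?case using assms(3) by auto
  next
    case (step i)
    then have "t i < t (i + 1)" using assms(3) by auto
    then show ?case using step by simp
  qed
  define w where "w k x = (x - t (k + 1)) / d (k + 1)" for k x
  define Z where "Z k x = (1 - of_real (w k x)) * z k + of_real (w k x) * z (k + 1)" for k x
  define R where "R k x = cubic_bezier (c k) (r (2*k+1)) (r (2*k+2)) (c (k+1)) (of_real (w k x))" for k x
  define f where "f = bspline (clamped_knots t m 4 2) 3 (2*m+1) r"
  define g where "g = bspline (clamped_knots t m 2 1) 1 m z"
  have d: "d (k + 1) = t (k + 2) - t (k + 1)" "d (k + 1) > 0" if "k < m" for k
    using assms(4) t[of "k + 1" "k + 2"] that by auto
  have w_ends: "w k (t (k + 1)) = 0" "w k (t (k + 2)) = 1" if "k < m" for k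
    using d[OF that] by (auto simp: w_def)
  have g: "g x = Z k x" and f: "f x = R k x"
    if "k < m" "x \<in> {t (k + 1)..<t (k + 2)} \<or> x = t (k + 2) \<and> k + 1 = m" for k x
  proof -
    show "g x = Z k x"
      using bspline_clamped_Bernstein[where t = t and n = 1 and a = z, OF m t _ that] that d(1)[OF that(1)]
      by (simp add: g_def Z_def w_def Bernstein_def numeral_2_eq_2)
    show "f x = R k x"
      using bspline_cubic_double_knots[where t = t, OF m t assms(4,5,6) c that]
      by (simp add: f_def R_def w_def)
  qed
  \<comment> \<open>At an interior knot the splines are evaluated in the next span. Both pieces have
    the same value there, \<open>z (k + 1)\<close> or \<open>c (k + 1)\<close>, so the formulas
    extend to closed spans, as the gluing of derivatives requires.\<close>
  have closed: "g x = Z k x" "f x = R k x" if kx: "k < m" "x \<in> {t (k + 1)..t (k + 2)}" for k x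
  proof -
    consider "x \<in> {t (k + 1)..<t (k + 2)} \<or> x = t (k + 2) \<and> k + 1 = m" | "x = t (k + 2)" "k + 1 < m"
      using kx by fastforce
    then have "g x = Z k x \<and> f x = R k x"
    proof cases
      case 1
      then show ?thesis using g f kx by blast
    next
      case 2
      have "x \<in> {t ((k + 1) + 1)..<t ((k + 1) + 2)}" using 2 t[of "k + 2" "k + 3"] by (simp add: numeral_eq_Suc)
      then have "g x = Z (k + 1) x" "f x = R (k + 1) x" using g f 2 by blast+
      then show ?thesis
        using w_ends(1)[of "k + 1"] w_ends(2)[of k] 2
        by (simp add: Z_def R_def cubic_bezier_def)
    qed
    then show "g x = Z k x" "f x = R k x" by auto
  qed
  have bezier_points: "r (2*k+1) = c k + of_real (d (k+1) / 3) * (z k)\<^sup>2"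
    "r (2*k+2) = r (2*k+1) + of_real (d (k+1) / 3) * z k * z (k+1)"
    "c (k+1) = r (2*k+2) + of_real (d (k+1) / 3) * (z (k+1))\<^sup>2" if "k < m" for k
  proof -
    \<comment> \<open>The conventions \<open>d 0 = 0\<close> and \<open>d (m + 1) = 0\<close> merge
      the two end steps with the interior steps of the recursion for \<open>r\<close>.\<close>
    have knot: "r (2*j+1) = r (2*j) + of_real ((d j + d (j+1)) / 3) * (z j)\<^sup>2" if "j \<le> m" for j
    proof -
      consider "j = 0" | "j = m" "j \<noteq> 0" | i where "j = i + 1" "i + 2 \<le> m"
        using \<open>j \<le> m\<close> by (cases j) force+
      then show ?thesis
      proof cases
        case 3
        then show ?thesis using assms(13) by (simp add: numeral_eq_Suc)
      qed (use assms in auto)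
    qed
    have d_pos: "d j + d (j + 1) > 0" if "j \<le> m" for j
      using d(2)[of j] d(2)[of "j - 1"] assms(5,6) m that by (cases "j = 0"; cases "j = m") force+
    \<comment> \<open>\<open>c j\<close> divides the segment from \<open>r (2*j)\<close> to
      \<open>r (2*j+1)\<close> in the ratio \<open>d j : d (j+1)\<close>, and \<open>knot\<close>
      gives the difference of its end points.\<close>
    have c': "c j = r (2*j) + of_real (d j / 3) * (z j)\<^sup>2"
      "c j = r (2*j+1) - of_real (d (j+1) / 3) * (z j)\<^sup>2" if "j \<le> m" for j
    proof -
      define e where "e = d j + d (j + 1)"
      have "e > 0" using d_pos[OF that] by (simp add: e_def)
      then have compl: "d (j + 1) / e = 1 - d j / e" and "d j / 3 = d j / e * (e / 3)"
        by (simp_all add: e_def field_simps)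
      then have cancel: "complex_of_real (d j / 3) = of_real (d j / e) * of_real (e / 3)"
        by (simp only: of_real_mult)
      show "c j = r (2*j) + of_real (d j / 3) * (z j)\<^sup>2"
        unfolding c[rule_format, OF that, folded e_def] knot[OF that, folded e_def] compl cancel of_real_diff
        by (simp only: of_real_1) algebra
      then show "c j = r (2*j+1) - of_real (d (j+1) / 3) * (z j)\<^sup>2"
        unfolding knot[OF that] by (simp add: algebra_simps add_divide_distrib)
    qed
    show "r (2*k+1) = c k + of_real (d (k+1) / 3) * (z k)\<^sup>2"
      using c'(2)[of k] that by simp
    show "r (2*k+2) = r (2*k+1) + of_real (d (k+1) / 3) * z k * z (k+1)"
      using assms(12) that by blast
    show "c (k+1) = r (2*k+2) + of_real (d (k+1) / 3) * (z (k+1))\<^sup>2"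
      using c'(1)[of "k+1"] that by simp
  qed
  fix s assume s: "s \<in> {t 1..t (m + 1)}"
  \<comment> \<open>This is r' = z^2, glued from the spans. \<open>t (0 + 1)\<close> keeps the shape
    of the first breakpoint of \<open>\<lambda>k. t (k + 1)\<close>.\<close>
  have "(f has_vector_derivative (g s)\<^sup>2) (at s within {t (0 + 1)..t (m + 1)})"
  proof (rule has_vector_derivative_piecewise[of m "\<lambda>k. t (k + 1)"])
    fix k assume k: "k < m" and sk: "s \<in> {t (k + 1)..t (Suc k + 1)}"
    have "(R k has_vector_derivative (Z k s)\<^sup>2) (at s within {t (k + 1)..t (Suc k + 1)})"
      using cubic_bezier_has_vector_derivative[OF _ bezier_points[OF k]] d[OF k]
      by (simp add: R_def[abs_def] Z_def w_def)
    then show "(f has_vector_derivative (g s)\<^sup>2) (at s within {t (k + 1)..t (Suc k + 1)})"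
      using closed[OF k] sk by (auto intro: has_vector_derivative_transform)
  next
    show "0 < m" using m by simp
    fix k assume "k < m"
    then show "t (k + 1) \<le> t (Suc k + 1)" using t[of "k + 1" "k + 2"] by simp
  qed
  \<comment> \<open>The derivative within the interval is unique because
    \<open>t 1 < t (m + 1)\<close>.\<close>
  then have deriv: "vector_derivative f (at s within {t 1..t (m + 1)}) = (g s)\<^sup>2"
    using s t[of 1 "m + 1"] m by (intro vector_derivative_within_closed_interval) auto
  obtain k where k: "k < m" and sk: "s \<in> {t (k + 1)..<t (k + 2)} \<or> s = t (k + 2) \<and> k + 1 = m"
    using exists_span[OF m s] .
  define W where "W = complex_of_real (w k s)"
  have Zs: "g s = (1 - W) * z k + W * z (k + 1)"
    using g[OF k sk] by (simp add: Z_def W_def)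
  have cnj_Zs: "cnj (g s) = (1 - W) * cnj (z k) + W * cnj (z (k + 1))"
    unfolding Zs by (simp add: W_def)
  have quintic: "bspline (clamped_knots t m 6 5) 5 (5*m) a s =
      (1 - W)^5 * a (5*k) + 5 * W * (1 - W)^4 * a (5*k+1) + 10 * W^2 * (1 - W)^3 * a (5*k+2)
      + 10 * W^3 * (1 - W)^2 * a (5*k+3) + 5 * W^4 * (1 - W) * a (5*k+4) + W^5 * a (5*(k+1))" for a
  proof -
    have sum: "(\<Sum>l\<le>5. F l) = F 0 + F 1 + F 2 + F 3 + F 4 + F 5" for F :: "nat \<Rightarrow> complex"
      by (simp add: numeral_eq_Suc)
    have binomials: "5 choose 1 = (5::nat)" "5 choose 2 = (10::nat)" "5 choose 3 = (10::nat)" "5 choose 4 = (5::nat)"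
      by (simp_all add: eval_nat_numeral)
    have "bspline (clamped_knots t m 6 5) 5 (5*m) a s =
      (\<Sum>l\<le>5. a (5*k + l) * of_real (Bernstein 5 l (w k s)))"
      using bspline_clamped_Bernstein[where t = t and n = 5 and a = a, OF m t _ k sk] d(1)[OF k]
      by (simp add: w_def mult.commute[of _ 5])
    moreover have "5 * (k + 1) = 5 * k + 5" by simp
    ultimately show ?thesis
      unfolding sum Bernstein_def binomials by (simp only:) (simp add: W_def mult_ac)
  qed
  \<comment> \<open>Coefficients that belong to the span are taken at \<open>k\<close>, those that
    belong to knots at both \<open>k\<close> and \<open>k + 1\<close>.\<close>
  note data = assms(9,10,18-21,23-26)[rule_format, OF k]
    assms(7,8,17,22)[rule_format, OF less_imp_le[OF k]]
    assms(7,8,17,22)[rule_format, of "k + 1", OF Suc_leI[OF k, unfolded Suc_eq_plus1]]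
  have even: "2 * k + 2 = 2 * (k + 1)" by simp
  \<comment> \<open>The Bernstein identity is applied from right to left. \<open>cnj_Zs\<close> has
    to be unfolded first, because \<open>Zs\<close> would rewrite the argument of
    \<open>cnj\<close>.\<close>
  have \<gamma>: "bspline (clamped_knots t m 6 5) 5 (5*m) \<gamma> s = g s * cnj (g s)"
    unfolding cnj_Zs unfolding Zs offset_weight_numerator_Bernstein(1)[symmetric] quintic data even ..
  have q: "bspline (clamped_knots t m 6 5) 5 (5*m) q s = f s * (g s * cnj (g s)) - \<i> * of_real h * (g s)\<^sup>2"
    unfolding cnj_Zs f[OF k sk] R_def W_def[symmetric] unfolding Zs offset_weight_numerator_Bernstein(2)[symmetric] quintic data even ..
  have ne: "g s \<noteq> 0" using z_ne_0 s by (simp add: g_def)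
  \<comment> \<open>Since r' is a square, its norm is the polynomial \<open>g s * cnj (g s)\<close>
    on the span; this is what makes the offset rational.\<close>
  have norm: "complex_of_real (norm ((g s)\<^sup>2)) = g s * cnj (g s)"
    using complex_norm_square[of "g s"] by (simp add: norm_power)
  show "bspline (clamped_knots t m 6 5) 5 (5*m) \<gamma> s \<noteq> 0 \<and>
      offset_curve {t 1..t (m+1)} (bspline (clamped_knots t m 4 2) 3 (2*m+1) r) h s
        = bspline (clamped_knots t m 6 5) 5 (5*m) q s / bspline (clamped_knots t m 6 5) 5 (5*m) \<gamma> s"
    unfolding f_def[symmetric] offset_curve_def deriv \<gamma> q norm using ne by (simp add: diff_divide_distrib)
qed

end
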